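(* Let $\mathcal H$ be a finite dimensional Hilbert space over $\mathbf F\in\{\mathbf{R},\mathbf{C}\}$ and $W:\mathbf{R}^d\to\mathcal L(\mathcal H)$ a matrix weight. Let $p\in(0,\infty]$, $r\in(0,\infty)$ and $s\in(\mathbf{R}\setminus\{0\})\cup\{\infty\}$ with $p\ge r$, $\frac1p\ge\frac1s$ and $r\ne s$. Assume that $[W]_{p,(r,s),\mathrm{op}}<\infty$. Then, for all $v\in\mathcal H\setminus\{0\}$, $$\big[\|Wv\|_{\mathcal H}^\rho\big]_\kappa^{1/\rho}\le[W]_{p,(r,s),\mathrm{op}},$$ where $$\frac1\kappa:=\frac{\frac1p-\frac1s}{\frac1r-\frac1s}\in[0,1]\qquad\text{and}\qquad\frac1\rho:=\frac1r-\frac1s.$$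
   Context: $\frac1\infty:=0$. A matrix weight is a measurable, a.e. self-adjoint positive definite operator-valued map. $[W]_{p,(r,s),\mathrm{op}}:=\sup_Q\Big(\frac1{|Q|}\int_Q\Big(\frac1{|Q|}\int_Q\|W(x)W(y)^{-1}\|_{\mathcal H\to\mathcal H}^t\,dy\Big)^{q/t}dx\Big)^{1/q}$ with $\frac1q:=\frac1p-\frac1s$, $\frac1t:=\frac1r-\frac1p$, the supremum over all cubes $Q\subseteq\mathbf{R}^d$, averages being essential suprema when the exponent is infinite. For a scalar weight $w$ and $\kappa\in[1,\infty]$, $[w]_\kappa:=\sup_Q\big(\frac1{|Q|}\int_Qw^\kappa\,dx\big)^{1/\kappa}\big(\frac1{|Q|}\int_Qw^{-\kappa'}\,dx\big)^{1/\kappa'}$, $\frac1{\kappa'}=1-\frac1\kappa$, with the same convention. *)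

theory Defs
  imports "HOL-Analysis.Analysis" "HOL-Probability.Essential_Supremum"
begin

section \<open>Finite dimensional Hilbert spaces over the reals or the complex numbers\<close>

text \<open>
  The scalar field is the subset \<open>F\<close> of the complex numbers, which is either the reals or
  everything; \<open>scl\<close> is scalar multiplication, only constrained for scalars in \<open>F\<close>,
  and \<open>ip\<close> is the \<open>F\<close>-valued inner product.  Finite dimensionality and the norm come from the
  real Euclidean space obtained by restriction of scalars, to which \<open>F\<close>-scaling and inner
  product are tied by the axioms \<open>scl_of_real\<close> and \<open>ip_self\<close>.  The class
  \<^class>\<open>euclidean_space\<close> excludes only the zero space, which has no nonzero vectors.
\<close>

locale fin_dim_hilbert_space =
  fixes F :: "complex set"
    and scl :: "complex \<Rightarrow> 'h::euclidean_space \<Rightarrow> 'h"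
    and ip :: "'h \<Rightarrow> 'h \<Rightarrow> complex"
  assumes field: "F = \<real> \<or> F = UNIV"
    and scl_add_right: "a \<in> F \<Longrightarrow> scl a (x + y) = scl a x + scl a y"
    and scl_add_left: "a \<in> F \<Longrightarrow> b \<in> F \<Longrightarrow> scl (a + b) x = scl a x + scl b x"
    and scl_scl: "a \<in> F \<Longrightarrow> b \<in> F \<Longrightarrow> scl a (scl b x) = scl (a * b) x"
    and scl_of_real: "scl (of_real c) x = c *\<^sub>R x"
    and ip_in_field: "ip x y \<in> F"
    and ip_add_left: "ip (x + y) z = ip x z + ip y z"
    and ip_scl_left: "a \<in> F \<Longrightarrow> ip (scl a x) y = a * ip x y"
    and ip_commute: "ip y x = cnj (ip x y)"
    and ip_self: "ip x x = of_real ((norm x)\<^sup>2)"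

text \<open>The standard real and complex examples.\<close>

lemma fin_dim_hilbert_space_real:
  "fin_dim_hilbert_space \<real> (\<lambda>a x. Re a *\<^sub>R x)
     (\<lambda>x y :: 'h::euclidean_space. complex_of_real (x \<bullet> y))"
  by unfold_locales
    (auto simp: algebra_simps inner_add_left inner_commute power2_norm_eq_inner elim!: Reals_cases)

lemma fin_dim_hilbert_space_complex:
  "fin_dim_hilbert_space UNIV (\<lambda>a x. \<chi> i. a * x $ i)
     (\<lambda>x y :: complex ^ 'n. \<Sum>i\<in>UNIV. x $ i * cnj (y $ i))"
proof unfold_locales
  fix x :: "complex ^ 'n"
  show "(\<Sum>i\<in>UNIV. x $ i * cnj (x $ i)) = of_real ((norm x)\<^sup>2)"
    by (simp add: norm_vec_def L2_set_def sum_nonneg complex_norm_square del: of_real_power)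
qed (auto simp: vec_eq_iff algebra_simps scaleR_conv_of_real[where 'a = complex] sum.distrib sum_distrib_left)

definition linear_over ::
  "complex set \<Rightarrow> (complex \<Rightarrow> 'h \<Rightarrow> 'h) \<Rightarrow> ('h::euclidean_space \<Rightarrow>\<^sub>L 'h) \<Rightarrow> bool" where
  "linear_over F scl A \<longleftrightarrow> (\<forall>a\<in>F. \<forall>u. A (scl a u) = scl a (A u))"

definition selfadjoint_op ::
  "('h \<Rightarrow> 'h \<Rightarrow> complex) \<Rightarrow> ('h::euclidean_space \<Rightarrow>\<^sub>L 'h) \<Rightarrow> bool" where
  "selfadjoint_op ip A \<longleftrightarrow> (\<forall>u v. ip (A u) v = ip u (A v))"

definition pos_def_op ::
  "('h \<Rightarrow> 'h \<Rightarrow> complex) \<Rightarrow> ('h::euclidean_space \<Rightarrow>\<^sub>L 'h) \<Rightarrow> bool" where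
  "pos_def_op ip A \<longleftrightarrow> (\<forall>u. u \<noteq> 0 \<longrightarrow> ip (A u) u \<in> \<real> \<and> 0 < Re (ip (A u) u))"


section \<open>Matrix weights\<close>

definition matrix_weight ::
  "complex set \<Rightarrow> (complex \<Rightarrow> 'h \<Rightarrow> 'h) \<Rightarrow> ('h \<Rightarrow> 'h \<Rightarrow> complex) \<Rightarrow>
   (real ^ 'd \<Rightarrow> 'h::euclidean_space \<Rightarrow>\<^sub>L 'h) \<Rightarrow> bool" where
  "matrix_weight F scl ip W \<longleftrightarrow>
     W \<in> borel_measurable lebesgue \<and>
     (\<forall>x. linear_over F scl (W x)) \<and>
     (AE x in lebesgue. selfadjoint_op ip (W x) \<and> pos_def_op ip (W x))"


section \<open>Averages over cubes and weight constants\<close>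

definition cubes :: "(real ^ 'd) set set" where
  "cubes = {cbox a (\<chi> i. a $ i + l) | a l. l > 0}"

text \<open>Power of an extended nonnegative real; only meant for exponents \<open>a > 0\<close>.\<close>

definition ennpow :: "ennreal \<Rightarrow> real \<Rightarrow> ennreal" where
  "ennpow x a = (if x = \<infinity> then \<infinity> else ennreal (enn2real x powr a))"

text \<open>The normalised \<open>L\<^sup>a\<close> (quasi-)norm over \<open>Q\<close>, for \<open>0 < a \<le> \<infinity>\<close>.\<close>

definition lp_avg :: "ereal \<Rightarrow> (real ^ 'd) set \<Rightarrow> (real ^ 'd \<Rightarrow> ennreal) \<Rightarrow> ennreal" where
  "lp_avg a Q f =
     (if a = \<infinity> then esssup (lebesgue_on Q) f
      else ennpow ((\<integral>\<^sup>+ x. ennpow (f x) (real_of_ereal a) \<partial>lebesgue_on Q) / emeasure lebesgue Q)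
             (1 / real_of_ereal a))"

text \<open>
  In \<^typ>\<open>ereal\<close> one has \<open>1 / \<infinity> = 0\<close> and \<open>1 / 0 = \<infinity>\<close>, so that an exponent whose reciprocal
  is \<open>0\<close> is indeed \<open>\<infinity>\<close>.  The inverse \<open>W(y)\<inverse>\<close> is the inverse function, which is a linear
  operator for almost every \<open>y\<close>.
\<close>

definition matrix_weight_const ::
  "ereal \<Rightarrow> ereal \<Rightarrow> ereal \<Rightarrow> (real ^ 'd \<Rightarrow> 'h::euclidean_space \<Rightarrow>\<^sub>L 'h) \<Rightarrow> ennreal" where
  "matrix_weight_const p r s W =
     (let q = 1 / (1 / p - 1 / s); t = 1 / (1 / r - 1 / p)
      in SUP Q \<in> cubes.
           lp_avg q Q (\<lambda>x. lp_avg t Q (\<lambda>y. ennreal (onorm (W x \<circ> inv (blinfun_apply (W y)))))))"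

text \<open>
  The second factor is written as the \<open>L\<^bsup>\<kappa>'\<^esup>\<close> average of \<open>w\<inverse>\<close>; the inverse is taken in
  \<^typ>\<open>ennreal\<close>, where \<open>0\<inverse> = \<infinity>\<close>.
\<close>

definition scalar_weight_const :: "ereal \<Rightarrow> (real ^ 'd \<Rightarrow> real) \<Rightarrow> ennreal" where
  "scalar_weight_const \<kappa> w =
     (let \<kappa>' = 1 / (1 - 1 / \<kappa>)
      in SUP Q \<in> cubes.
           lp_avg \<kappa> Q (\<lambda>x. ennreal (w x)) * lp_avg \<kappa>' Q (\<lambda>x. inverse (ennreal (w x))))"

end

theory Submission
  imports Defs
begin

text \<open>
  Fix \<open>v \<noteq> 0\<close> and write \<open>n(x) = \<parallel>W(x) v\<parallel>\<close>.  Testing the operator \<open>W(x) W(y)\<inverse>\<close> on the vector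
  \<open>W(y) v\<close> gives \<open>n(x) n(y)\<inverse> \<le> \<parallel>W(x) W(y)\<inverse>\<parallel>\<close> whenever \<open>W(y)\<close> is positive definite, hence for
  all \<open>x\<close> and almost every \<open>y\<close>.  In this lower bound the variables are separated, so averaging
  first in \<open>y\<close> and then in \<open>x\<close> yields \<open>\<langle>n\<rangle>\<^sub>q \<langle>n\<inverse>\<rangle>\<^sub>t \<le> [W]\<close> on every cube
  (lemma \<open>lp_avg_product_le_iterated\<close>).

  The exponents are chosen so that \<open>\<kappa> \<rho> = q\<close> and \<open>\<kappa>' \<rho> = t\<close>: indeed
  \<open>1/\<kappa> = \<rho> (1/p - 1/s) = \<rho>/q\<close> and \<open>1 - 1/\<kappa> = \<rho> (1/r - 1/p) = \<rho>/t\<close>.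
  Therefore \<open>\<langle>n\<^sup>\<rho>\<rangle>\<^sub>\<kappa> \<langle>n\<^sup>-\<^sup>\<rho>\<rangle>\<^bsub>\<kappa>'\<^esub>\<close> is the \<open>\<rho>\<close>-th power of \<open>\<langle>n\<rangle>\<^sub>q \<langle>n\<inverse>\<rangle>\<^sub>t\<close>
  (lemma \<open>lp_avg_ennpow_le\<close>), and the claim follows on taking the supremum over cubes.
  Exponents are parametrised throughout by their reciprocals, which turns the infinite exponent
  into the ordinary value \<open>0\<close> and makes these relations identities between real numbers.
\<close>

section \<open>Powers of extended nonnegative reals\<close>

lemma ennpow_mono: "0 \<le> a \<Longrightarrow> x \<le> y \<Longrightarrow> ennpow x a \<le> ennpow y a"
  by (cases x; cases y) (auto simp: ennpow_def top_unique intro!: ennreal_leI powr_mono2)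

lemma ennpow_mult: "ennpow (x * y) a = ennpow x a * ennpow y a"
proof (cases "x = top \<or> y = top")
  case True
  then show ?thesis
    by (cases x; cases y)
      (auto simp: ennpow_def ennreal_mult_top ennreal_top_mult)
next
  case False
  then show ?thesis
    by (cases x; cases y)
      (auto simp: ennpow_def ennreal_mult[symmetric] powr_mult ennreal_mult_eq_top_iff)
qed

lemma ennpow_ennpow: "ennpow (ennpow x a) b = ennpow x (a * b)"
  by (cases x) (auto simp: ennpow_def powr_powr)

lemma ennpow_one [simp]: "ennpow x 1 = x"
  by (cases x) (auto simp: ennpow_def)

lemma ennpow_ennreal: "0 \<le> x \<Longrightarrow> ennpow (ennreal x) a = ennreal (x powr a)"
  by (simp add: ennpow_def)

lemma ennpow_inverse:
  assumes "0 < a"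
  shows "ennpow (inverse x) a = inverse (ennpow x a)"
proof (cases x)
  case (real u)
  then show ?thesis
    by (cases "u = 0") (auto simp: ennpow_def inverse_ennreal inverse_powr)
qed (use assms in \<open>auto simp: ennpow_def\<close>)

lemma borel_measurable_ennpow [measurable]:
  assumes [measurable]: "f \<in> borel_measurable M"
  shows "(\<lambda>x. ennpow (f x) a) \<in> borel_measurable M"
  unfolding ennpow_def by measurable

section \<open>Averages over a set\<close>

lemma one_divide_ereal: "1 / ereal b = (if b = 0 then \<infinity> else ereal (1 / b))"
  by (simp add: one_ereal_def)

text \<open>
  The larger function may be non-measurable: its essential supremum is then \<open>\<infinity>\<close> by convention,
  and the lower integral behind the finite exponents is monotone anyway.  This matters because
  \<open>g\<close> will involve the inverse function of \<open>W(y)\<close>, which is arbitrary on a null set.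
\<close>

lemma lp_avg_mono_AE:
  assumes b: "0 \<le> b" and f: "f \<in> borel_measurable (lebesgue_on Q)"
    and le: "AE x in lebesgue_on Q. f x \<le> g x"
  shows "lp_avg (1 / ereal b) Q f \<le> lp_avg (1 / ereal b) Q g"
proof (cases "b = 0")
  case True
  have "esssup (lebesgue_on Q) f \<le> esssup (lebesgue_on Q) g"
  proof (cases "g \<in> borel_measurable (lebesgue_on Q)")
    case True
    have "AE x in lebesgue_on Q. f x \<le> esssup (lebesgue_on Q) g"
      using esssup_AE[of g "lebesgue_on Q"] le by eventually_elim simp
    then show ?thesis by (rule esssup_I[OF f])
  next
    case False
    then show ?thesis by (simp add: esssup_non_measurable)
  qed
  with True show ?thesis by (simp add: one_divide_ereal lp_avg_def)
next
  case False
  have "(\<integral>\<^sup>+x. ennpow (f x) (1 / b) \<partial>lebesgue_on Q) \<le> (\<integral>\<^sup>+x. ennpow (g x) (1 / b) \<partial>lebesgue_on Q)"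
    using le by (intro nn_integral_mono_AE) (elim eventually_mono, use b in \<open>simp add: ennpow_mono\<close>)
  then show ?thesis
    using b False
    by (auto simp: one_divide_ereal lp_avg_def intro!: ennpow_mono divide_right_mono_ennreal)
qed

text \<open>
  Infinite constants have to be allowed, since the constant pulled out of the outer average is
  itself an average.
\<close>

lemma lp_avg_cmult_ge:
  assumes b: "0 \<le> b" and f [measurable]: "f \<in> borel_measurable (lebesgue_on Q)"
  shows "c * lp_avg (1 / ereal b) Q f \<le> lp_avg (1 / ereal b) Q (\<lambda>x. c * f x)"
proof (cases "b = 0")
  case True
  let ?M = "lebesgue_on Q"
  define E where "E = esssup ?M (\<lambda>x. c * f x)"
  have AE_E: "AE x in ?M. c * f x \<le> E"
    unfolding E_def by (rule esssup_AE)
  have "c * esssup ?M f \<le> E"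
  proof (cases "c = 0 \<or> E = top")
    case False
    show ?thesis
    proof (cases "c = top")
      case True
      \<comment> \<open>A finite bound for \<open>\<infinity> * f\<close> forces \<open>f = 0\<close> almost everywhere.\<close>
      have "AE x in ?M. f x \<le> 0"
        using AE_E by eventually_elim (use True False in \<open>auto simp: ennreal_top_mult top_unique split: if_splits\<close>)
      then have "esssup ?M f \<le> 0" by (rule esssup_I[OF f])
      then show ?thesis by simp
    next
      case fin: False
      have "AE x in ?M. f x \<le> E / c"
        using AE_E
      proof eventually_elim
        case (elim x)
        then have "c * f x / c \<le> E / c" by (rule divide_right_mono_ennreal)
        then show ?case using False fin
          by (simp add: mult_divide_eq_ennreal mult.commute[of c])
      qed
      then have "esssup ?M f \<le> E / c" by (rule esssup_I[OF f])
      then have "c * esssup ?M f \<le> c * (E / c)" by (rule mult_left_mono) simp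
      also have "\<dots> = E" using False fin
        by (simp add: ennreal_times_divide mult_divide_eq_ennreal mult.commute[of c])
      finally show ?thesis .
    qed
  qed auto
  with True show ?thesis by (simp add: one_divide_ereal lp_avg_def E_def)
next
  case False
  have "(\<integral>\<^sup>+x. ennpow (c * f x) (1 / b) \<partial>lebesgue_on Q)
      = ennpow c (1 / b) * (\<integral>\<^sup>+x. ennpow (f x) (1 / b) \<partial>lebesgue_on Q)"
    by (simp add: ennpow_mult nn_integral_cmult)
  with False show ?thesis
    by (simp add: one_divide_ereal lp_avg_def ennreal_times_divide[symmetric] ennpow_mult ennpow_ennpow)
qed

text \<open>
  This is the identity \<open>\<langle>f\<^sup>\<rho>\<rangle>\<^bsub>a/\<rho>\<^esub> = \<langle>f\<rangle>\<^sub>a\<^sup>\<rho>\<close> for \<open>a = 1/b\<close>; the stated half avoids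
  recovering \<open>f\<close> from its power when \<open>a = \<infinity>\<close>.
\<close>

lemma lp_avg_ennpow_le:
  assumes b: "0 \<le> b" and \<rho>: "0 < \<rho>" and f [measurable]: "f \<in> borel_measurable (lebesgue_on Q)"
  shows "lp_avg (1 / ereal (b * \<rho>)) Q (\<lambda>x. ennpow (f x) \<rho>) \<le> ennpow (lp_avg (1 / ereal b) Q f) \<rho>"
proof (cases "b = 0")
  case True
  have "AE x in lebesgue_on Q. ennpow (f x) \<rho> \<le> ennpow (esssup (lebesgue_on Q) f) \<rho>"
    using esssup_AE[of f "lebesgue_on Q"] by eventually_elim (use \<rho> in \<open>simp add: ennpow_mono\<close>)
  then have "esssup (lebesgue_on Q) (\<lambda>x. ennpow (f x) \<rho>) \<le> ennpow (esssup (lebesgue_on Q) f) \<rho>"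
    by (rule esssup_I[rotated]) measurable
  with True show ?thesis by (simp add: one_divide_ereal lp_avg_def)
next
  case False
  with \<rho> show ?thesis by (simp add: one_divide_ereal lp_avg_def ennpow_ennpow)
qed

section \<open>Testing the operator norm on a vector\<close>

lemma (in fin_dim_hilbert_space) ip_zero_left: "ip 0 u = 0"
  using ip_add_left[of 0 0 u] by simp

lemma (in fin_dim_hilbert_space) pos_def_op_inj:
  assumes "pos_def_op ip A"
  shows "inj (blinfun_apply A)"
proof -
  have "u = 0" if "blinfun_apply A u = 0" for u
    using assms that by (force simp: pos_def_op_def ip_zero_left)
  then show ?thesis
    using linear_injective_0[OF bounded_linear.linear[OF blinfun.bounded_linear_right[of A]]]
    by blast
qed

text \<open>The operator \<open>A B\<inverse>\<close> is tested on the vector \<open>B v\<close>, which it sends to \<open>A v\<close>.\<close>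

lemma norm_ratio_le_onorm:
  fixes A B :: "'h::euclidean_space \<Rightarrow>\<^sub>L 'h"
  assumes inj: "inj (blinfun_apply B)" and v: "v \<noteq> 0"
  shows "ennreal (norm (A v)) * inverse (ennreal (norm (B v)))
    \<le> ennreal (onorm (A \<circ> inv (blinfun_apply B)))"
proof -
  have "bounded_linear (inv (blinfun_apply B))"
    by (rule inj_linear_imp_inv_bounded_linear[OF blinfun.bounded_linear_right inj])
  then have "bounded_linear (A \<circ> inv (blinfun_apply B))"
    unfolding comp_def
    by (rule bounded_linear_compose[OF blinfun.bounded_linear_right])
  from onorm[OF this, of "B v"]
  have le: "norm (A v) \<le> onorm (A \<circ> inv (blinfun_apply B)) * norm (B v)"
    using inj by simp
  have pos: "0 < norm (B v)"
    using inj v by (metis blinfun.zero_right injD zero_less_norm_iff)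
  have "norm (A v) * inverse (norm (B v)) \<le> onorm (A \<circ> inv (blinfun_apply B))"
    using le pos by (simp add: field_simps)
  then show ?thesis
    using pos by (simp add: inverse_ennreal ennreal_mult[symmetric] ennreal_leI)
qed

lemma matrix_weight_norm_measurable:
  fixes W :: "real ^ 'd \<Rightarrow> 'h::euclidean_space \<Rightarrow>\<^sub>L 'h"
  assumes "matrix_weight F scl ip W"
  shows "(\<lambda>x. norm (W x v)) \<in> borel_measurable lebesgue"
proof -
  have "continuous_on UNIV (\<lambda>A :: 'h \<Rightarrow>\<^sub>L 'h. norm (A v))"
    by (intro continuous_intros)
  moreover have "W \<in> borel_measurable lebesgue"
    using assms by (simp add: matrix_weight_def)
  ultimately show ?thesis
    by (rule borel_measurable_continuous_on)
qed

lemma lp_avg_product_le_iterated: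
  assumes hilb: "fin_dim_hilbert_space F scl ip" and W: "matrix_weight F scl ip W"
    and v: "v \<noteq> 0" and a: "0 \<le> a" and b: "0 \<le> b" and Q: "Q \<in> sets lebesgue"
  shows "lp_avg (1 / ereal a) Q (\<lambda>x. ennreal (norm (W x v)))
      * lp_avg (1 / ereal b) Q (\<lambda>y. inverse (ennreal (norm (W y v))))
    \<le> lp_avg (1 / ereal a) Q (\<lambda>x. lp_avg (1 / ereal b) Q
        (\<lambda>y. ennreal (onorm (W x \<circ> inv (blinfun_apply (W y))))))"
proof -
  define B where "B = lp_avg (1 / ereal b) Q (\<lambda>y. inverse (ennreal (norm (W y v))))"
  have [measurable]: "(\<lambda>x. norm (W x v)) \<in> borel_measurable (lebesgue_on Q)"
    using W by (intro measurable_restrict_space1 matrix_weight_norm_measurable)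
  have "AE y in lebesgue. inj (blinfun_apply (W y))"
    by (rule eventually_mono[OF conjunct2[OF conjunct2[OF W[unfolded matrix_weight_def]]]])
      (simp add: fin_dim_hilbert_space.pos_def_op_inj[OF hilb])
  then have AE_inj: "AE y in lebesgue_on Q. inj (blinfun_apply (W y))"
    using Q by (auto simp: AE_restrict_space_iff elim!: eventually_mono)
  have inner: "ennreal (norm (W x v)) * B
      \<le> lp_avg (1 / ereal b) Q (\<lambda>y. ennreal (onorm (W x \<circ> inv (blinfun_apply (W y)))))" for x
  proof -
    have "ennreal (norm (W x v)) * B
        \<le> lp_avg (1 / ereal b) Q (\<lambda>y. ennreal (norm (W x v)) * inverse (ennreal (norm (W y v))))"
      unfolding B_def by (rule lp_avg_cmult_ge[OF b]) measurable
    also have "\<dots> \<le> lp_avg (1 / ereal b) Q (\<lambda>y. ennreal (onorm (W x \<circ> inv (blinfun_apply (W y)))))"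
      using AE_inj v
      by (intro lp_avg_mono_AE[OF b]) (auto intro: norm_ratio_le_onorm elim!: eventually_mono)
    finally show ?thesis .
  qed
  have "B * lp_avg (1 / ereal a) Q (\<lambda>x. ennreal (norm (W x v)))
      \<le> lp_avg (1 / ereal a) Q (\<lambda>x. B * ennreal (norm (W x v)))"
    by (rule lp_avg_cmult_ge[OF a]) measurable
  also have "\<dots> \<le> lp_avg (1 / ereal a) Q (\<lambda>x. lp_avg (1 / ereal b) Q
        (\<lambda>y. ennreal (onorm (W x \<circ> inv (blinfun_apply (W y))))))"
    using inner by (intro lp_avg_mono_AE[OF a]) (simp_all add: mult.commute)
  finally show ?thesis by (simp add: B_def mult.commute)
qed

text \<open>
  For reciprocal exponents \<open>a = 1/q\<close> and \<open>b = 1/t\<close>, the scalar weight \<open>\<parallel>W v\<parallel>\<^sup>\<rho>\<close> has the conjugate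
  pair \<open>1/\<kappa> = a \<rho>\<close> and \<open>1/\<kappa>' = b \<rho>\<close>.
\<close>

lemma scalar_lp_avg_product_le:
  assumes hilb: "fin_dim_hilbert_space F scl ip" and W: "matrix_weight F scl ip W"
    and v: "v \<noteq> 0" and a: "0 \<le> a" and b: "0 \<le> b" and \<rho>: "0 < \<rho>" and Q: "Q \<in> sets lebesgue"
  shows "lp_avg (1 / ereal (a * \<rho>)) Q (\<lambda>x. ennreal (norm (W x v) powr \<rho>))
      * lp_avg (1 / ereal (b * \<rho>)) Q (\<lambda>x. inverse (ennreal (norm (W x v) powr \<rho>)))
    \<le> ennpow (lp_avg (1 / ereal a) Q (\<lambda>x. lp_avg (1 / ereal b) Q
        (\<lambda>y. ennreal (onorm (W x \<circ> inv (blinfun_apply (W y))))))) \<rho>"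
proof -
  have [measurable]: "(\<lambda>x. norm (W x v)) \<in> borel_measurable (lebesgue_on Q)"
    using W by (intro measurable_restrict_space1 matrix_weight_norm_measurable)
  have "lp_avg (1 / ereal (a * \<rho>)) Q (\<lambda>x. ennpow (ennreal (norm (W x v))) \<rho>)
      * lp_avg (1 / ereal (b * \<rho>)) Q (\<lambda>x. ennpow (inverse (ennreal (norm (W x v)))) \<rho>)
    \<le> ennpow (lp_avg (1 / ereal a) Q (\<lambda>x. ennreal (norm (W x v)))) \<rho>
      * ennpow (lp_avg (1 / ereal b) Q (\<lambda>y. inverse (ennreal (norm (W y v))))) \<rho>"
    by (intro mult_mono lp_avg_ennpow_le a b \<rho>) simp_all
  also have "\<dots> \<le> ennpow (lp_avg (1 / ereal a) Q (\<lambda>x. lp_avg (1 / ereal b) Q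
        (\<lambda>y. ennreal (onorm (W x \<circ> inv (blinfun_apply (W y))))))) \<rho>"
    unfolding ennpow_mult[symmetric]
    using \<rho> by (intro ennpow_mono lp_avg_product_le_iterated[OF hilb W v a b Q]) simp
  finally show ?thesis
    using \<rho> by (simp add: ennpow_inverse ennpow_ennreal)
qed

section \<open>The scalar weights of a matrix weight\<close>

lemma one_divide_ereal_real:
  assumes "(x::ereal) \<noteq> 0"
  shows "1 / x = ereal (real_of_ereal (1 / x))"
  using assms by (cases x) (auto simp: one_ereal_def)

theorem proposition4p11:
  fixes F :: "complex set"
    and scl :: "complex \<Rightarrow> 'h::euclidean_space \<Rightarrow> 'h"
    and ip :: "'h \<Rightarrow> 'h \<Rightarrow> complex"
    and W :: "real ^ 'd \<Rightarrow> 'h \<Rightarrow>\<^sub>L 'h"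
    and p r s \<kappa> :: ereal and \<rho> :: real
  assumes "fin_dim_hilbert_space F scl ip"
    and "matrix_weight F scl ip W"
    and "0 < p"
    and "0 < r" "r < \<infinity>"
    and "s \<noteq> 0" "s \<noteq> -\<infinity>"
    and "p \<ge> r" "1 / p \<ge> 1 / s" "r \<noteq> s"
    and "matrix_weight_const p r s W < \<infinity>"
    and "\<kappa> = 1 / ((1 / p - 1 / s) / (1 / r - 1 / s))"
    and "\<rho> = real_of_ereal (1 / (1 / r - 1 / s))"
  shows "(1 / p - 1 / s) / (1 / r - 1 / s) \<in> {0..1} \<and>
    (\<forall>v. v \<noteq> 0 \<longrightarrow>
      ennpow (scalar_weight_const \<kappa> (\<lambda>x. norm (W x v) powr \<rho>)) (1 / \<rho>)
        \<le> matrix_weight_const p r s W)"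
proof -
  \<comment> \<open>Only the reciprocals enter, and these are real numbers.\<close>
  define P R S where "P = real_of_ereal (1 / p)" and "R = real_of_ereal (1 / r)"
    and "S = real_of_ereal (1 / s)"
  have recip: "1 / p = ereal P" "1 / r = ereal R" "1 / s = ereal S"
    unfolding P_def R_def S_def using assms(3,4,6) by (auto intro!: one_divide_ereal_real)
  have SP: "S \<le> P"
    using assms(9) by (simp add: recip)
  have PR: "P \<le> R"
    using assms(3,4,5,8) unfolding P_def R_def
    by (cases p; cases r) (auto simp: one_ereal_def field_simps)
  have "S \<noteq> R"
    using assms(4,5,6,7,10) unfolding S_def R_def
    by (cases s; cases r) (auto simp: one_ereal_def)
  with SP PR have SR: "0 < R - S" by simp
  have \<rho>: "\<rho> = 1 / (R - S)" "0 < \<rho>"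
    using SR by (simp_all add: assms(13) recip one_divide_ereal)
  have quot: "(1 / p - 1 / s) / (1 / r - 1 / s) = ereal ((P - S) * \<rho>)"
    using SR by (simp add: recip \<rho>)
  have recip_\<kappa>: "1 / \<kappa> = ereal ((P - S) * \<rho>)"
    unfolding assms(12) quot by (simp add: one_divide_ereal)
  have recip_\<kappa>': "1 - 1 / \<kappa> = ereal ((R - P) * \<rho>)"
    using SR unfolding recip_\<kappa> by (simp add: \<rho> one_ereal_def field_simps)
  have "(1 / p - 1 / s) / (1 / r - 1 / s) \<in> {0..1}"
    using SP PR SR unfolding quot by (simp add: \<rho> field_simps)
  moreover have "ennpow (scalar_weight_const \<kappa> (\<lambda>x. norm (W x v) powr \<rho>)) (1 / \<rho>)
      \<le> matrix_weight_const p r s W" if v: "v \<noteq> 0" for v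
  proof -
    have "scalar_weight_const \<kappa> (\<lambda>x. norm (W x v) powr \<rho>)
        \<le> ennpow (matrix_weight_const p r s W) \<rho>"
      unfolding scalar_weight_const_def Let_def
    proof (rule SUP_least)
      fix Q :: "(real ^ 'd) set"
      assume Q: "Q \<in> cubes"
      let ?avg = "lp_avg (1 / ereal (P - S)) Q (\<lambda>x. lp_avg (1 / ereal (R - P)) Q
        (\<lambda>y. ennreal (onorm (W x \<circ> inv (blinfun_apply (W y))))))"
      have "Q \<in> sets lebesgue"
        using Q by (auto simp: cubes_def)
      then have "lp_avg \<kappa> Q (\<lambda>x. ennreal (norm (W x v) powr \<rho>))
          * lp_avg (1 / (1 - 1 / \<kappa>)) Q (\<lambda>x. inverse (ennreal (norm (W x v) powr \<rho>)))
        \<le> ennpow ?avg \<rho>"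
        using scalar_lp_avg_product_le[OF assms(1,2) v _ _ \<rho>(2), of "P - S" "R - P" Q] SP PR
        unfolding recip_\<kappa>' unfolding assms(12) quot by simp
      also have "?avg \<le> matrix_weight_const p r s W"
        unfolding matrix_weight_const_def Let_def recip ereal_minus(1)
        by (rule SUP_upper[OF Q])
      then have "ennpow ?avg \<rho> \<le> ennpow (matrix_weight_const p r s W) \<rho>"
        using \<rho>(2) by (intro ennpow_mono) simp_all
      finally show "lp_avg \<kappa> Q (\<lambda>x. ennreal (norm (W x v) powr \<rho>))
          * lp_avg (1 / (1 - 1 / \<kappa>)) Q (\<lambda>x. inverse (ennreal (norm (W x v) powr \<rho>)))
        \<le> ennpow (matrix_weight_const p r s W) \<rho>" .
    qed
    then have "ennpow (scalar_weight_const \<kappa> (\<lambda>x. norm (W x v) powr \<rho>)) (1 / \<rho>)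
        \<le> ennpow (ennpow (matrix_weight_const p r s W) \<rho>) (1 / \<rho>)"
      using \<rho>(2) by (intro ennpow_mono) simp_all
    then show ?thesis
      using \<rho>(2) by (simp add: ennpow_ennpow)
  qed
  ultimately show ?thesis by blast
qed

end
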